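(* Suppose Assumption A holds. Then $\overline{\mathrm{conv}(S)}\subseteq\widetilde{\mathrm{TH}}_k(\tilde G)$ for every integer $k\ge1$, the sets $\widetilde{\mathrm{TH}}_k(\tilde G)$ are decreasing in $k$, and $$\overline{\mathrm{conv}(S)}=\bigcap_{k=1}^\infty\widetilde{\mathrm{TH}}_k(\tilde G).$$
   Context: $X=(X_1,\dots,X_n)$, $\tilde X=(X_0,X_1,\dots,X_n)$, $\|\cdot\|_2$ Euclidean norm. For $f\in\mathbb{R}[X]$ of degree $d$, its homogenization is $\tilde f(\tilde X)=X_0^df(X/X_0)\in\mathbb{R}[\tilde X]$. Fix $g_1,\dots,g_m\in\mathbb{R}[X]$ and $S=\{x\in\mathbb{R}^n:g_1(x)\ge0,\dots,g_m(x)\ge0\}$. Define $\tilde S^{o}=\{\tilde x=(x_0,x)\in\mathbb{R}^{n+1}:\tilde g_j(\tilde x)\ge0\ (j=1,\dots,m),\ x_0>0\}$, $\tilde S^{c}$ the same set with $x_0\ge0$ in place of $x_0>0$, and $\tilde S=\tilde S^c\cap\{\|\tilde x\|_2=1\}$. $S$ is closed at $\infty$ if $\overline{\tilde S^{o}}=\tilde S^{c}$. For a finite set $H=\{h_1,\dots,h_r\}$ of polynomials, the $k$-th quadratic module is $\mathcal{Q}_k(H)=\{\sum_{j=0}^r\sigma_jh_j:h_0=1,\ \sigma_j\text{ sums of squares of polynomials},\ \deg(\sigma_jh_j)\le2k\}$. Let $\tilde G=\{\tilde g_1,\dots,\tilde g_m,X_0,\|\tilde X\|_2^2-1,1-\|\tilde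 X\|_2^2\}$. Let $\mathcal{P}[\tilde X]_1$ be the set of linear forms (homogeneous of degree one) in $\tilde X$ together with $0$. The modified theta body is $\widetilde{\mathrm{TH}}_k(\tilde G)=\{x\in\mathbb{R}^n:\tilde l(1,x)\ge0\ \forall\tilde l\in\mathcal{Q}_k(\tilde G)\cap\mathcal{P}[\tilde X]_1\}$. A closed convex cone $K$ is pointed if $K\cap(-K)=\{0\}$. Assumption A: (i) $S$ is closed at $\infty$; (ii) the convex cone $\mathrm{conv}(\overline{\tilde S^{o}})$ is closed and pointed. $\mathrm{conv}$ denotes convex hull, overline closure. *)

theory Defs
  imports "HOL-Analysis.Analysis" "HOL-Library.Poly_Mapping"
begin

text \<open>Real multivariate polynomials in variables indexed by 'v:
  finitely supported maps from monomials (exponent vectors) to coefficients.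
  Multiplication is the convolution product of Poly_Mapping (a comm_ring_1).\<close>

type_synonym 'v rpoly = "('v \<Rightarrow>\<^sub>0 nat) \<Rightarrow>\<^sub>0 real"

definition mdeg :: "('v \<Rightarrow>\<^sub>0 nat) \<Rightarrow> nat" where
  "mdeg m = (\<Sum>i\<in>Poly_Mapping.keys m. Poly_Mapping.lookup m i)"

definition pdeg :: "'v rpoly \<Rightarrow> nat" where
  "pdeg p = Max (insert 0 (mdeg ` Poly_Mapping.keys p))"

definition peval :: "'v rpoly \<Rightarrow> ('v \<Rightarrow> real) \<Rightarrow> real" where
  "peval p x = (\<Sum>m\<in>Poly_Mapping.keys p. Poly_Mapping.lookup p m * (\<Prod>i\<in>Poly_Mapping.keys m. x i ^ Poly_Mapping.lookup m i))"

definition pvar :: "'v \<Rightarrow> 'v rpoly" where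
  "pvar i = Poly_Mapping.single (Poly_Mapping.single i 1) 1"

text \<open>Homogenization: the variable X_0 is None, X_i is Some i.
  tilde f = sum_m c_m X_0^(d - |m|) X^m, which equals X_0^d f(X/X_0), d = deg f.\<close>
definition lift_mono :: "('v \<Rightarrow>\<^sub>0 nat) \<Rightarrow> ('v option \<Rightarrow>\<^sub>0 nat)" where
  "lift_mono m = (\<Sum>i\<in>Poly_Mapping.keys m. Poly_Mapping.single (Some i) (Poly_Mapping.lookup m i))"

definition homog :: "'v rpoly \<Rightarrow> 'v option rpoly" where
  "homog p = (\<Sum>m\<in>Poly_Mapping.keys p.
      Poly_Mapping.single (Poly_Mapping.single None (pdeg p - mdeg m) + lift_mono m) (Poly_Mapping.lookup p m))"

definition sos :: "'v rpoly \<Rightarrow> bool" where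
  "sos s \<longleftrightarrow> (\<exists>qs. s = (\<Sum>q\<leftarrow>qs. q ^ 2))"

definition qmodule :: "nat \<Rightarrow> 'v rpoly set \<Rightarrow> 'v rpoly set" where
  "qmodule k H = {p. \<exists>s0 s. p = s0 + (\<Sum>h\<in>H. s h * h) \<and> sos s0 \<and> pdeg s0 \<le> 2 * k \<and>
      (\<forall>h\<in>H. sos (s h) \<and> pdeg (s h * h) \<le> 2 * k)}"

definition linforms :: "'v rpoly set" where
  "linforms = {p. \<forall>m\<in>Poly_Mapping.keys p. mdeg m = 1}"

definition hpt :: "real \<Rightarrow> real ^ 'n::finite \<Rightarrow> ('n option \<Rightarrow> real)" where
  "hpt x0 x = (\<lambda>j. case j of None \<Rightarrow> x0 | Some i \<Rightarrow> x $ i)"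

definition hvec :: "real ^ ('n::finite option) \<Rightarrow> ('n option \<Rightarrow> real)" where
  "hvec y = (\<lambda>j. y $ j)"

definition semialg :: "'n::finite rpoly list \<Rightarrow> (real ^ 'n) set" where
  "semialg gs = {x. \<forall>g\<in>set gs. 0 \<le> peval g (\<lambda>i. x $ i)}"

definition Stilde_o :: "'n::finite rpoly list \<Rightarrow> (real ^ 'n option) set" where
  "Stilde_o gs = {y. (\<forall>g\<in>set gs. 0 \<le> peval (homog g) (hvec y)) \<and> y $ None > 0}"

definition Stilde_c :: "'n::finite rpoly list \<Rightarrow> (real ^ 'n option) set" where
  "Stilde_c gs = {y. (\<forall>g\<in>set gs. 0 \<le> peval (homog g) (hvec y)) \<and> y $ None \<ge> 0}"

definition closed_at_infinity :: "'n::finite rpoly list \<Rightarrow> bool" where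
  "closed_at_infinity gs \<longleftrightarrow> closure (Stilde_o gs) = Stilde_c gs"

definition pointed :: "'a::real_vector set \<Rightarrow> bool" where
  "pointed K \<longleftrightarrow> K \<inter> uminus ` K = {0}"

definition assumptionA :: "'n::finite rpoly list \<Rightarrow> bool" where
  "assumptionA gs \<longleftrightarrow> closed_at_infinity gs \<and>
     closed (convex hull (closure (Stilde_o gs))) \<and> pointed (convex hull (closure (Stilde_o gs)))"

definition sqnorm_poly :: "'v::finite rpoly" where
  "sqnorm_poly = (\<Sum>i\<in>UNIV. pvar i ^ 2)"

definition Gtilde :: "'n::finite rpoly list \<Rightarrow> 'n option rpoly set" where
  "Gtilde gs = homog ` set gs \<union> {pvar None, sqnorm_poly - 1, 1 - sqnorm_poly}"

definition THk :: "nat \<Rightarrow> 'n::finite rpoly list \<Rightarrow> (real ^ 'n) set" where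
  "THk k gs = {x. \<forall>l\<in>qmodule k (Gtilde gs) \<inter> linforms. 0 \<le> peval l (hpt 1 x)}"

end

theory Submission
  imports Defs
begin

text \<open>
  If \<open>x\<close> lies outside \<open>closure (conv S)\<close>, then \<open>(1, x)\<close> lies outside the pointed cone
  \<open>K = conv (closure S\<^sup>o)\<close>, and a single separation argument yields a linear form that is negative at
  \<open>(1, x)\<close> and positive on the compact set of unit vectors cut out by the generators. By Putinar's
  theorem this form lies in the quadratic module, so \<open>x\<close> is excluded by some theta body.

  Putinar's theorem is elementary for modules containing the sphere relation. Modulo
  \<open>\<parallel>X\<parallel>\<^sup>2 - 1\<close> each \<open>1 \<plusminus> X\<^sub>i\<close> is a sum of squares, hence so is every product of such
  factors. A polynomial positive on the sphere becomes positive on the cube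
  \<open>[-1, 1]\<^sup>N\<close> after adding a multiple of \<open>(\<parallel>X\<parallel>\<^sup>2 - 1)\<^sup>2\<close>; its Bernstein coefficients of high
  degree are then nonnegative, so it is a sum of squares modulo the sphere relation.
\<close>

section \<open>Evaluation of polynomials\<close>

abbreviation pconst :: "real \<Rightarrow> 'v rpoly" where
  "pconst \<equiv> Poly_Mapping.single 0"

text \<open>The product runs over all variables rather than over the support, so exponents add
  without comparing supports.\<close>

definition meval :: "('v::finite \<Rightarrow>\<^sub>0 nat) \<Rightarrow> ('v \<Rightarrow> real) \<Rightarrow> real" where
  "meval m x = (\<Prod>i\<in>UNIV. x i ^ Poly_Mapping.lookup m i)"

lemma meval_keys: "(\<Prod>i\<in>Poly_Mapping.keys m. x i ^ Poly_Mapping.lookup m i) = meval m x"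
  unfolding meval_def
  by (rule prod.mono_neutral_left) (auto simp: in_keys_iff)

lemma mdeg_eq_sum: "mdeg (m :: 'v::finite \<Rightarrow>\<^sub>0 nat) = (\<Sum>i\<in>UNIV. Poly_Mapping.lookup m i)"
  unfolding mdeg_def
  by (rule sum.mono_neutral_left) (auto simp: in_keys_iff)

lemma peval_meval: "peval p x = (\<Sum>m\<in>Poly_Mapping.keys p. Poly_Mapping.lookup p m * meval m x)"
  by (simp add: peval_def meval_keys)

lemma meval_0 [simp]: "meval 0 x = 1"
  by (simp add: meval_def)

lemma meval_add: "meval (m + n) x = meval m x * meval n x"
  by (simp add: meval_def lookup_add power_add prod.distrib)

lemma meval_sum: "meval (sum f A) x = (\<Prod>a\<in>A. meval (f a) x)"
  by (induction A rule: infinite_finite_induct) (simp_all add: meval_add)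

lemma meval_single: "meval (Poly_Mapping.single i n) x = x i ^ n"
proof -
  have "meval (Poly_Mapping.single i n) x = (\<Prod>j\<in>UNIV. if j = i then x i ^ n else 1)"
    unfolding meval_def by (rule prod.cong) (auto simp: lookup_single when_def)
  then show ?thesis by simp
qed

lemma meval_scale: "meval m (\<lambda>i. c * x i) = c ^ mdeg m * meval m x"
  by (simp add: meval_def mdeg_eq_sum power_mult_distrib prod.distrib power_sum)

lemma peval_single: "peval (Poly_Mapping.single m c) x = c * meval m x"
  by (simp add: peval_meval)

lemma peval_0 [simp]: "peval 0 x = 0"
  by (simp add: peval_def)

lemma peval_add [simp]: "peval (p + q) x = peval p x + peval q (x :: 'v::finite \<Rightarrow> real)"
  unfolding peval_meval
  by (rule setsum_keys_plus_distrib[where f = "\<lambda>m c. c * meval m x"]) (auto simp: algebra_simps)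

lemma peval_sum: "peval (sum f A) x = (\<Sum>a\<in>A. peval (f a) (x :: 'v::finite \<Rightarrow> real))"
  by (induction A rule: infinite_finite_induct) simp_all

lemma sum_monomials: "(\<Sum>m\<in>Poly_Mapping.keys p. Poly_Mapping.single m (Poly_Mapping.lookup p m)) = p"
  by (rule poly_mapping_eqI) (auto simp: lookup_sum lookup_single when_def in_keys_iff)

lemma peval_mult [simp]: "peval (p * q) x = peval p x * peval q (x :: 'v::finite \<Rightarrow> real)"
proof -
  have "peval (p * q) x = peval ((\<Sum>m\<in>Poly_Mapping.keys p. Poly_Mapping.single m (Poly_Mapping.lookup p m)) *
      (\<Sum>m\<in>Poly_Mapping.keys q. Poly_Mapping.single m (Poly_Mapping.lookup q m))) x"
    by (simp only: sum_monomials)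
  also have "\<dots> = peval p x * peval q x"
    by (simp add: sum_product peval_sum mult_single peval_single meval_add
        peval_meval[of p] peval_meval[of q] algebra_simps)
  finally show ?thesis .
qed

lemma peval_pconst [simp]: "peval (pconst c) (x :: 'v::finite \<Rightarrow> real) = c"
  by (simp add: peval_single)

lemma peval_1 [simp]: "peval 1 (x :: 'v::finite \<Rightarrow> real) = 1"
  by (metis peval_pconst single_one)

lemma peval_uminus [simp]: "peval (- p) x = - peval p (x :: 'v::finite \<Rightarrow> real)"
  using peval_add[of p "- p" x] by (simp del: peval_add)

lemma peval_diff [simp]: "peval (p - q) x = peval p x - peval q (x :: 'v::finite \<Rightarrow> real)"
  using peval_add[of p "- q" x] by (simp del: peval_add)

lemma peval_power [simp]: "peval (p ^ n) x = peval p (x :: 'v::finite \<Rightarrow> real) ^ n"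
  by (induction n) simp_all

lemma peval_pvar [simp]: "peval (pvar i) (x :: 'v::finite \<Rightarrow> real) = x i"
  by (simp add: pvar_def peval_single meval_single)

lemma peval_sum_list: "peval (sum_list ps) x = (\<Sum>p\<leftarrow>ps. peval p (x :: 'v::finite \<Rightarrow> real))"
  by (induction ps) simp_all

lemma peval_sqnorm_poly: "peval sqnorm_poly (\<lambda>i. x $ i) = (norm (x :: real ^ 'v::finite))\<^sup>2"
  by (simp add: sqnorm_poly_def peval_sum norm_vec_def L2_set_def sum_nonneg)

lemma continuous_on_peval: "continuous_on A (\<lambda>x :: real ^ 'v::finite. peval p (\<lambda>i. x $ i))"
  unfolding peval_meval meval_def by (intro continuous_intros)

section \<open>Constants and monomials in the polynomial ring\<close>

lemma pconst_mult: "pconst (a * b) = pconst a * pconst b"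
  by (simp add: mult_single)

lemma pconst_power: "pconst (a ^ n) = pconst a ^ n"
  by (induction n) (simp_all add: pconst_mult)

lemma pconst_sum: "pconst (sum f A) = (\<Sum>a\<in>A. pconst (f a))"
  by (induction A rule: infinite_finite_induct) (simp_all add: single_add)

lemma pconst_prod: "pconst (prod f A) = (\<Prod>a\<in>A. pconst (f a))"
  by (induction A rule: infinite_finite_induct) (simp_all add: pconst_mult)

lemma pvar_power: "pvar i ^ n = Poly_Mapping.single (Poly_Mapping.single i n) 1"
  by (induction n) (simp_all add: pvar_def mult_single single_add[symmetric])

lemma prod_single:
  "(\<Prod>i\<in>A. Poly_Mapping.single (f i) (1::real)) = Poly_Mapping.single (sum f A) 1"
  by (induction A rule: infinite_finite_induct) (simp_all add: mult_single)

lemma monomial_eq_prod_pvar: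
  "Poly_Mapping.single m c = pconst c * (\<Prod>i\<in>UNIV. pvar (i :: 'v::finite) ^ Poly_Mapping.lookup m i)"
proof -
  have "(\<Sum>i\<in>UNIV. Poly_Mapping.single i (Poly_Mapping.lookup m i)) = m"
    by (rule poly_mapping_eqI) (simp add: lookup_sum lookup_single when_def)
  then show ?thesis
    by (simp add: pvar_power prod_single mult_single)
qed

section \<open>Evaluation of homogenizations\<close>

lemma meval_homog_monomial:
  "meval (Poly_Mapping.single None n + lift_mono m) v =
     v None ^ n * meval m (\<lambda>i. v (Some i))"
  by (simp add: meval_add meval_single lift_mono_def meval_sum meval_keys)

lemma mdeg_le_pdeg: "m \<in> Poly_Mapping.keys p \<Longrightarrow> mdeg m \<le> pdeg p"
  by (simp add: pdeg_def)

text \<open>Every monomial of \<open>homog p\<close> has total degree \<open>pdeg p\<close>;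
  \<open>mdeg_le_pdeg\<close> makes the natural subtraction in the exponent of \<open>None\<close>
  exact.\<close>

lemma peval_homog_scale:
  "peval (homog p) (hvec (c *\<^sub>R y)) = c ^ pdeg p * peval (homog p) (hvec y)"
proof -
  have eq: "meval m (\<lambda>i. c * y $ Some i) = c ^ mdeg m * meval m (\<lambda>i. y $ Some i)" for m
    by (rule meval_scale)
  show ?thesis
    unfolding homog_def peval_sum peval_single meval_homog_monomial hvec_def sum_distrib_left
    using mdeg_le_pdeg[of _ p]
    by (intro sum.cong) (auto simp: eq power_mult_distrib power_add[symmetric] algebra_simps)
qed

lemma peval_homog_one: "y $ None = 1 \<Longrightarrow> peval (homog p) (hvec y) = peval p (\<lambda>i. y $ Some i)"
  by (simp add: homog_def peval_sum peval_single meval_homog_monomial hvec_def peval_meval[of p])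

section \<open>Sums of squares and quadratic modules\<close>

lemma sos_0 [simp]: "sos 0"
  unfolding sos_def by (rule exI[of _ "[]"]) simp

lemma sos_square: "sos (q ^ 2)"
  unfolding sos_def by (rule exI[of _ "[q]"]) simp

lemma sos_add: "sos s \<Longrightarrow> sos t \<Longrightarrow> sos (s + t)"
  unfolding sos_def by (metis map_append sum_list.append)

lemma sos_sum: "(\<And>a. a \<in> A \<Longrightarrow> sos (f a)) \<Longrightarrow> sos (sum f A)"
  by (induction A rule: infinite_finite_induct) (auto intro: sos_add)

lemma sos_square_mult: "sos t \<Longrightarrow> sos (q ^ 2 * t)"
proof -
  assume "sos t"
  then obtain ps where "t = (\<Sum>p\<leftarrow>ps. p ^ 2)" by (auto simp: sos_def)
  then have "q ^ 2 * t = (\<Sum>p\<leftarrow>map ((*) q) ps. p ^ 2)"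
    by (simp add: sum_list_const_mult[symmetric] power_mult_distrib o_def)
  then show ?thesis unfolding sos_def by blast
qed

lemma sos_mult: "sos s \<Longrightarrow> sos t \<Longrightarrow> sos (s * t)"
proof -
  assume s: "sos s" and t: "sos t"
  obtain ps where "s = (\<Sum>p\<leftarrow>ps. p ^ 2)" using s by (auto simp: sos_def)
  moreover have "sos ((\<Sum>p\<leftarrow>ps. p ^ 2) * t)"
    by (induction ps) (auto simp: distrib_right intro!: sos_add sos_square_mult t)
  ultimately show ?thesis by simp
qed

lemma sos_pconst: "0 \<le> c \<Longrightarrow> sos (pconst c)"
  using sos_square[of "pconst (sqrt c)"] by (simp add: pconst_power[symmetric])

lemma peval_sos_nonneg: "sos s \<Longrightarrow> 0 \<le> peval s (x :: 'v::finite \<Rightarrow> real)"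
  by (auto simp: sos_def peval_sum_list o_def intro!: sum_list_nonneg)

section \<open>Quadratic modules without degree bound\<close>

definition quadratic_module :: "'v rpoly set \<Rightarrow> 'v rpoly set" where
  "quadratic_module H = {p. \<exists>s0 s. p = s0 + (\<Sum>h\<in>H. s h * h) \<and> sos s0 \<and> (\<forall>h\<in>H. sos (s h))}"

lemma quadratic_moduleI:
  assumes "p = s0 + (\<Sum>h\<in>H. s h * h)" "sos s0" "\<And>h. h \<in> H \<Longrightarrow> sos (s h)"
  shows "p \<in> quadratic_module H"
  unfolding quadratic_module_def using assms by blast

lemma quadratic_module_eq_Union_qmodule:
  assumes "finite H"
  shows "quadratic_module H = (\<Union>k\<in>{1..}. qmodule k H)"
proof (intro equalityI subsetI)
  fix p assume "p \<in> quadratic_module H"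
  then obtain s0 s where p: "p = s0 + (\<Sum>h\<in>H. s h * h)" "sos s0" "\<forall>h\<in>H. sos (s h)"
    by (auto simp: quadratic_module_def)
  \<comment> \<open>The sum dominates every single degree, and \<open>Suc\<close> ensures
    \<open>1 \<le> k\<close>.\<close>
  define k where "k = Suc (pdeg s0 + (\<Sum>h\<in>H. pdeg (s h * h)))"
  have "pdeg (s h * h) \<le> 2 * k" if "h \<in> H" for h
    using member_le_sum[OF that, of "\<lambda>h. pdeg (s h * h)"] assms by (simp add: k_def)
  moreover have "pdeg s0 \<le> 2 * k" by (simp add: k_def)
  ultimately have "p \<in> qmodule k H" using p by (auto simp: qmodule_def)
  then show "p \<in> (\<Union>k\<in>{1..}. qmodule k H)" by (auto simp: k_def)
qed (auto simp: qmodule_def quadratic_module_def)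

lemma quadratic_module_add:
  assumes "p \<in> quadratic_module H" "q \<in> quadratic_module H"
  shows "p + q \<in> quadratic_module H"
proof -
  obtain s0 s where p: "p = s0 + (\<Sum>h\<in>H. s h * h)" "sos s0" "\<forall>h\<in>H. sos (s h)"
    using assms(1) by (auto simp: quadratic_module_def)
  obtain t0 t where q: "q = t0 + (\<Sum>h\<in>H. t h * h)" "sos t0" "\<forall>h\<in>H. sos (t h)"
    using assms(2) by (auto simp: quadratic_module_def)
  show ?thesis
  proof (rule quadratic_moduleI)
    show "p + q = (s0 + t0) + (\<Sum>h\<in>H. (s h + t h) * h)"
      by (simp add: p q distrib_right sum.distrib)
  qed (use p q in \<open>auto intro: sos_add\<close>)
qed

lemma sos_in_quadratic_module: "sos s \<Longrightarrow> s \<in> quadratic_module H"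
  unfolding quadratic_module_def
  by (auto intro!: exI[of _ s] exI[of _ "\<lambda>_. 0"])

lemma quadratic_module_sum:
  "(\<And>a. a \<in> A \<Longrightarrow> f a \<in> quadratic_module H) \<Longrightarrow> sum f A \<in> quadratic_module H"
  by (induction A rule: infinite_finite_induct)
    (auto intro: quadratic_module_add sos_in_quadratic_module)

lemma sos_mult_in_quadratic_module:
  assumes "finite H" "h \<in> H" "sos s"
  shows "s * h \<in> quadratic_module H"
proof -
  have "(\<Sum>g\<in>H. (if g = h then s else 0) * g) = (\<Sum>g\<in>H. if g = h then s * h else 0)"
    by (rule sum.cong) auto
  then have "s * h = 0 + (\<Sum>g\<in>H. (if g = h then s else 0) * g)"
    using assms by simp
  then show ?thesis by (rule quadratic_moduleI) (use assms in auto)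
qed

text \<open>\<open>q\<close> is the difference of the squares of \<open>(q + 1) / 2\<close> and
  \<open>(q - 1) / 2\<close>; one square multiplies \<open>h\<close>, the other \<open>- h\<close>.
  This gives access to arbitrary multiples of the sphere relation.\<close>

lemma mult_in_quadratic_module:
  assumes "finite H" "h \<in> H" "- h \<in> H"
  shows "q * h \<in> quadratic_module H"
proof -
  have half: "pconst (1/2) * 2 = 1"
    using pconst_mult[of "1/2" 2] by simp
  define a where "a = pconst (1/2) * (q + 1)"
  define b where "b = pconst (1/2) * (q - 1)"
  have "a + b = (pconst (1/2) * 2) * q" "a - b = pconst (1/2) * 2"
    unfolding a_def b_def by (simp_all add: algebra_simps)
  then have "a + b = q" "a - b = 1" by (simp_all only: half mult_1)
  then have "q = a\<^sup>2 - b\<^sup>2" by (metis mult.right_neutral power2_eq_square square_diff_square_factored)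
  then have "q * h = a\<^sup>2 * h + b\<^sup>2 * (- h)" by (simp only:) (simp add: algebra_simps)
  moreover have "a\<^sup>2 * h + b\<^sup>2 * (- h) \<in> quadratic_module H"
    using assms by (intro quadratic_module_add sos_mult_in_quadratic_module sos_square)
  ultimately show ?thesis by simp
qed

lemma peval_qmodule_nonneg:
  assumes "p \<in> qmodule k H" "\<And>h. h \<in> H \<Longrightarrow> 0 \<le> peval h (x :: 'v::finite \<Rightarrow> real)"
  shows "0 \<le> peval p x"
proof -
  obtain s0 s where p: "p = s0 + (\<Sum>h\<in>H. s h * h)" "sos s0" "\<forall>h\<in>H. sos (s h)"
    using assms(1) by (auto simp: qmodule_def)
  have "peval p x = peval s0 x + (\<Sum>h\<in>H. peval (s h) x * peval h x)"
    by (simp add: p(1) peval_sum)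
  then show ?thesis
    using p assms(2) by (simp add: peval_sos_nonneg sum_nonneg)
qed

lemma qmodule_mono: "j \<le> k \<Longrightarrow> qmodule j H \<subseteq> qmodule k H"
proof
  fix p assume "j \<le> k" "p \<in> qmodule j H"
  then show "p \<in> qmodule k H"
    unfolding qmodule_def by (fastforce intro: order_trans)
qed

section \<open>Polynomials that are sums of squares on the sphere\<close>

text \<open>Sums of squares modulo the ideal of the sphere relation. Unlike a general quadratic
  module, this set is closed under products, as the Bernstein argument requires.\<close>

definition sphere_sos :: "'v::finite rpoly set" where
  "sphere_sos = {p. \<exists>s q. sos s \<and> p = s + q * (sqnorm_poly - 1)}"

lemma sphere_sosI: "sos s \<Longrightarrow> s \<in> sphere_sos"
  unfolding sphere_sos_def by (rule CollectI, rule exI[of _ s], rule exI[of _ 0]) simp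

lemma sphere_sos_add: "p \<in> sphere_sos \<Longrightarrow> q \<in> sphere_sos \<Longrightarrow> p + q \<in> sphere_sos"
proof -
  assume "p \<in> sphere_sos" "q \<in> sphere_sos"
  then obtain s a t b where "sos s" "p = s + a * (sqnorm_poly - 1)" "sos t" "q = t + b * (sqnorm_poly - 1)"
    by (auto simp: sphere_sos_def)
  then have "sos (s + t)" "p + q = (s + t) + (a + b) * (sqnorm_poly - 1)"
    by (auto intro: sos_add simp: algebra_simps)
  then show ?thesis unfolding sphere_sos_def by blast
qed

lemma sphere_sos_sum: "(\<And>a. a \<in> A \<Longrightarrow> f a \<in> sphere_sos) \<Longrightarrow> sum f A \<in> sphere_sos"
  by (induction A rule: infinite_finite_induct) (auto intro: sphere_sos_add sphere_sosI)

lemma sphere_sos_mult: "p \<in> sphere_sos \<Longrightarrow> q \<in> sphere_sos \<Longrightarrow> p * q \<in> sphere_sos"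
proof -
  assume "p \<in> sphere_sos" "q \<in> sphere_sos"
  then obtain s a t b where st: "sos s" "sos t"
    and p: "p = s + a * (sqnorm_poly - 1)" and q: "q = t + b * (sqnorm_poly - 1)"
    by (auto simp: sphere_sos_def)
  have "p * q = s * t + (s * b + a * q) * (sqnorm_poly - 1)"
    unfolding p q by (simp add: algebra_simps)
  with st show ?thesis unfolding sphere_sos_def by (blast intro: sos_mult)
qed

lemma sphere_sos_pconst: "0 \<le> c \<Longrightarrow> pconst c \<in> sphere_sos"
  by (intro sphere_sosI sos_pconst)

lemma sphere_sos_power: "p \<in> sphere_sos \<Longrightarrow> p ^ n \<in> sphere_sos"
  using sphere_sos_pconst[of 1] by (induction n) (auto intro: sphere_sos_mult)

lemma sphere_sos_prod: "(\<And>a. a \<in> A \<Longrightarrow> f a \<in> sphere_sos) \<Longrightarrow> prod f A \<in> sphere_sos"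
  using sphere_sos_pconst[of 1]
  by (induction A rule: infinite_finite_induct) (auto intro: sphere_sos_mult)

text \<open>Modulo the sphere relation, \<open>2 (1 + u)\<close> with \<open>u\<close> a variable up to sign is
  \<open>(1 + u)\<^sup>2\<close> plus the sum of the squares of the other variables.\<close>

lemma one_plus_in_sphere_sos:
  assumes "u\<^sup>2 = (pvar i)\<^sup>2"
  shows "pconst (1/2) * (1 + u) \<in> sphere_sos"
proof -
  define r where "r = (\<Sum>j\<in>UNIV - {i}. (pvar j)\<^sup>2)"
  have r: "sqnorm_poly = u\<^sup>2 + r"
    unfolding sqnorm_poly_def r_def assms by (subst sum.remove[of _ i]) auto
  have half: "pconst (1/4) * 2 = pconst (1/2)"
    using pconst_mult[of "1/4" 2, symmetric] by simp
  have "pconst (1/4) * ((1 + u)\<^sup>2 + r) + (- pconst (1/4)) * (sqnorm_poly - 1)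
      = pconst (1/4) * 2 * (1 + u)"
    unfolding r by (simp add: algebra_simps power2_eq_square)
  moreover have "sos (pconst (1/4) * ((1 + u)\<^sup>2 + r))"
    unfolding r_def by (intro sos_mult sos_pconst sos_add sos_sum sos_square) simp
  ultimately show ?thesis unfolding sphere_sos_def half by (metis (mono_tags, lifting) mem_Collect_eq)
qed

lemma sphere_sos_subset_quadratic_module:
  fixes H :: "'v::finite rpoly set"
  assumes "finite H" "sqnorm_poly - 1 \<in> H" "1 - sqnorm_poly \<in> H"
  shows "sphere_sos \<subseteq> quadratic_module H"
proof
  fix p :: "'v rpoly" assume "p \<in> sphere_sos"
  then obtain s q where "sos s" "p = s + q * (sqnorm_poly - 1)"
    by (auto simp: sphere_sos_def)
  then show "p \<in> quadratic_module H"
    using assms quadratic_module_add sos_in_quadratic_module mult_in_quadratic_module by fastforce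
qed

section \<open>Bernstein coefficients\<close>

text \<open>Multiply by \<open>1 = (y + (1 - y)) ^ (n - j)\<close>, expand, and regroup the
  binomials by \<open>choose_mult\<close>. The ring is arbitrary so that \<open>y\<close> may itself
  be a polynomial.\<close>

lemma binomial_power_eq_bernstein_sum:
  fixes y :: "'a::comm_ring_1"
  assumes "j \<le> n"
  shows "of_nat (n choose j) * y ^ j =
    (\<Sum>k\<le>n. of_nat (k choose j) * (of_nat (n choose k) * y ^ k * (1 - y) ^ (n - k)))"
proof -
  let ?f = "\<lambda>k. of_nat (k choose j) * (of_nat (n choose k) * y ^ k * (1 - y) ^ (n - k))"
  have "(\<Sum>k\<le>n. ?f k) = (\<Sum>k\<in>{j..n}. ?f k)"
    by (rule sum.mono_neutral_right) (auto simp: binomial_eq_0)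
  also have "\<dots> = (\<Sum>i\<in>{0..n-j}. ?f (j + i))"
    by (simp only: sum.atLeastAtMost_shift_0[OF assms] o_def)
  also have "\<dots> = (\<Sum>i\<in>{0..n-j}. of_nat (n choose j) * y ^ j *
      (of_nat ((n - j) choose i) * y ^ i * (1 - y) ^ (n - j - i)))"
  proof (rule sum.cong)
    fix i assume "i \<in> {0..n-j}"
    then have "(n choose (j + i)) * ((j + i) choose j) = (n choose j) * ((n - j) choose i)"
      using choose_mult[of j "j + i" n] assms by simp
    then have "(of_nat ((j + i) choose j) * of_nat (n choose (j + i)) :: 'a) =
        of_nat (n choose j) * of_nat ((n - j) choose i)"
      by (metis mult.commute of_nat_mult)
    then show "?f (j + i) = of_nat (n choose j) * y ^ j *
        (of_nat ((n - j) choose i) * y ^ i * (1 - y) ^ (n - j - i))"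
      by (simp add: power_add mult_ac) (simp add: mult.assoc[symmetric])
  qed simp
  also have "\<dots> = of_nat (n choose j) * y ^ j * (y + (1 - y)) ^ (n - j)"
    by (simp only: binomial_ring sum_distrib_left atMost_atLeast0)
  finally show ?thesis by simp
qed

text \<open>The coefficient of index \<open>k\<close> of the monomial \<open>x ^ a\<close> in the
  Bernstein basis of degree \<open>n\<close> on \<open>[-1, 1]\<close>, for
  \<open>a \<le> n\<close>.\<close>

definition bernstein_coeff :: "nat \<Rightarrow> nat \<Rightarrow> nat \<Rightarrow> real" where
  "bernstein_coeff n a k = (\<Sum>j\<le>a. real (a choose j) * 2 ^ j * (-1) ^ (a - j) *
     (real (k choose j) / real (n choose j)))"

text \<open>Bernstein basis polynomials transported from \<open>[0, 1]\<close> to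
  \<open>[-1, 1]\<close>. Writing \<open>1 + - pvar i\<close> lets
  \<open>one_plus_in_sphere_sos\<close> cover both factors.\<close>

definition bernstein :: "nat \<Rightarrow> nat \<Rightarrow> 'v \<Rightarrow> 'v rpoly" where
  "bernstein n k i = of_nat (n choose k) * (pconst (1/2) * (1 + pvar i)) ^ k *
     (pconst (1/2) * (1 + - pvar i)) ^ (n - k)"

lemma bernstein_in_sphere_sos: "bernstein n k i \<in> sphere_sos"
proof -
  have "of_nat (n choose k) = pconst (real (n choose k))" by simp
  then have "(of_nat (n choose k) :: 'a rpoly) \<in> sphere_sos"
    by (metis of_nat_0_le_iff sphere_sos_pconst)
  then show ?thesis
    unfolding bernstein_def
    by (intro sphere_sos_mult sphere_sos_power one_plus_in_sphere_sos) auto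
qed

text \<open>With \<open>y = (1 + x) / 2\<close>, expand \<open>x ^ a = (2 y - 1) ^ a\<close>
  binomially and then each \<open>y ^ j\<close> in the Bernstein basis; \<open>a \<le> n\<close>
  keeps the divisors \<open>n choose j\<close> nonzero.\<close>

lemma pvar_power_eq_bernstein_sum:
  fixes i :: 'v
  assumes "a \<le> n"
  shows "pvar i ^ a = (\<Sum>k\<le>n. pconst (bernstein_coeff n a k) * bernstein n k i)"
proof -
  define y where "y = pconst (1/2) * (1 + pvar i)"
  have half: "2 * pconst (1/2) = 1"
    using pconst_mult[of 2 "1/2"] by simp
  have y1: "1 - y = pconst (1/2) * (1 + - pvar i)"
  proof -
    have "1 - y = 2 * pconst (1/2) - y" by (simp only: half)
    also have "\<dots> = pconst (1/2) * (1 + - pvar i)"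
      unfolding y_def by (simp add: algebra_simps)
    finally show ?thesis .
  qed
  have x: "pvar i = 2 * y + (- 1)"
    unfolding y_def mult.assoc[symmetric] half by simp
  have y: "y ^ j = (\<Sum>k\<le>n. pconst (real (k choose j) / real (n choose j)) * bernstein n k i)"
    if "j \<le> a" for j
  proof -
    have inv: "pconst (1 / real (n choose j)) * of_nat (n choose j) = 1"
      using pconst_mult[of "1 / real (n choose j)" "real (n choose j)"] that assms by simp
    have "y ^ j = pconst (1 / real (n choose j)) * (of_nat (n choose j) * y ^ j)"
      by (simp add: mult.assoc[symmetric] inv)
    also have "of_nat (n choose j) * y ^ j = (\<Sum>k\<le>n. of_nat (k choose j) * bernstein n k i)"
      unfolding bernstein_def y1[symmetric] y_def[symmetric]
      by (rule binomial_power_eq_bernstein_sum) (use that assms in simp)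
    also have "pconst (1 / real (n choose j)) * \<dots> =
        (\<Sum>k\<le>n. pconst (real (k choose j) / real (n choose j)) * bernstein n k i)"
    proof -
      have "pconst (1 / real (n choose j)) * of_nat (k choose j) =
          (pconst (real (k choose j) / real (n choose j)) :: 'v rpoly)" for k
        using pconst_mult[of "1 / real (n choose j)" "real (k choose j)", symmetric] by simp
      then show ?thesis
        unfolding sum_distrib_left mult.assoc[symmetric] by (intro sum.cong) (simp_all only:)
    qed
    finally show ?thesis .
  qed
  have "pvar i ^ a = (\<Sum>j\<le>a. of_nat (a choose j) * (2 * y) ^ j * (- 1) ^ (a - j))"
    unfolding x by (rule binomial_ring)
  also have "\<dots> = (\<Sum>j\<le>a. pconst (real (a choose j) * 2 ^ j * (-1) ^ (a - j)) * y ^ j)"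
  proof (rule sum.cong)
    fix j
    have "(pconst (real (a choose j) * 2 ^ j * (-1) ^ (a - j)) :: 'v rpoly) =
        of_nat (a choose j) * 2 ^ j * (-1) ^ (a - j)"
      by (simp only: pconst_mult pconst_power single_uminus single_one single_numeral single_of_nat)
    then show "of_nat (a choose j) * (2 * y) ^ j * (- 1) ^ (a - j) =
        pconst (real (a choose j) * 2 ^ j * (-1) ^ (a - j)) * y ^ j"
      by (simp only: power_mult_distrib mult_ac)
  qed simp
  also have "\<dots> = (\<Sum>j\<le>a. \<Sum>k\<le>n. pconst (real (a choose j) * 2 ^ j * (-1) ^ (a - j) *
      (real (k choose j) / real (n choose j))) * bernstein n k i)"
    by (rule sum.cong) (simp_all only: y sum_distrib_left pconst_mult mult.assoc atMost_iff)
  also have "\<dots> = (\<Sum>k\<le>n. pconst (bernstein_coeff n a k) * bernstein n k i)"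
    by (subst sum.swap) (simp add: bernstein_coeff_def pconst_sum sum_distrib_right)
  finally show ?thesis .
qed

text \<open>The quotient is the product of \<open>(k - i) / (N - i)\<close> over
  \<open>i < j\<close>; after division by \<open>N\<close> above and below, each factor tends to
  \<open>t\<close>.\<close>

lemma binomial_quotient_tendsto:
  assumes N: "filterlim N at_top sequentially"
    and k: "(\<lambda>m. real (k m) / real (N m)) \<longlonglongrightarrow> t"
  shows "(\<lambda>m. real (k m choose j) / real (N m choose j)) \<longlonglongrightarrow> t ^ j"
proof -
  have inv: "(\<lambda>m. real i / real (N m)) \<longlonglongrightarrow> 0" for i
    by (intro tendsto_divide_0[OF tendsto_const] filterlim_at_top_imp_at_infinity
        filterlim_compose[OF filterlim_real_sequentially N])
  have "(\<lambda>m. \<Prod>i<j. (real (k m) / real (N m) - real i / real (N m)) / (1 - real i / real (N m)))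
      \<longlonglongrightarrow> (\<Prod>i<j. (t - 0) / (1 - 0))"
    by (intro tendsto_intros k inv) simp
  moreover have "\<forall>\<^sub>F m in sequentially.
      (\<Prod>i<j. (real (k m) / real (N m) - real i / real (N m)) / (1 - real i / real (N m)))
      = real (k m choose j) / real (N m choose j)"
    \<comment> \<open>Once \<open>N m > j\<close>, the divisors \<open>N m\<close> and
      \<open>N m - i\<close> with \<open>i < j\<close> are nonzero.\<close>
    using N[unfolded filterlim_at_top, rule_format, of "Suc j"]
  proof eventually_elim
    case (elim m)
    have "(\<Prod>i<j. (real (k m) / real (N m) - real i / real (N m)) / (1 - real i / real (N m)))
        = (\<Prod>i<j. (real (k m) - real i) / (real (N m) - real i))"
      using elim by (intro prod.cong) (auto simp: divide_simps)
    \<comment> \<open>Falling products with the factorials cancelled; generalized binomials also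
      cover \<open>k m < j\<close>.\<close>
    also have "\<dots> = (real (k m) gchoose j) / (real (N m) gchoose j)"
      by (simp add: gbinomial_prod_rev prod_dividef atLeast0LessThan)
    finally show ?case by (simp add: binomial_gbinomial)
  qed
  ultimately show ?thesis
    by (auto dest: Lim_transform_eventually)
qed

text \<open>For large degree the coefficients approach the values of \<open>x ^ a\<close> at the
  grid points, where \<open>x = 2 t - 1\<close>: the limit is taken termwise and summed by the
  binomial theorem.\<close>

lemma bernstein_coeff_tendsto:
  assumes N: "filterlim N at_top sequentially"
    and k: "(\<lambda>m. real (k m) / real (N m)) \<longlonglongrightarrow> t"
  shows "(\<lambda>m. bernstein_coeff (N m) a (k m)) \<longlonglongrightarrow> (2 * t - 1) ^ a"
proof -
  have "(\<lambda>m. bernstein_coeff (N m) a (k m)) \<longlonglongrightarrow>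
      (\<Sum>j\<le>a. real (a choose j) * 2 ^ j * (-1) ^ (a - j) * t ^ j)"
    unfolding bernstein_coeff_def by (intro tendsto_intros binomial_quotient_tendsto[OF N k])
  also have "(\<Sum>j\<le>a. real (a choose j) * 2 ^ j * (-1) ^ (a - j) * t ^ j) = (2 * t + (-1)) ^ a"
    unfolding binomial_ring by (rule sum.cong) (auto simp: power_mult_distrib)
  finally show ?thesis by simp
qed

text \<open>Tensor product version: the same degree \<open>n\<close> in every variable, with
  multi-index \<open>K\<close>.\<close>

definition poly_bernstein_coeff :: "nat \<Rightarrow> 'v::finite rpoly \<Rightarrow> ('v \<Rightarrow> nat) \<Rightarrow> real" where
  "poly_bernstein_coeff n p K = (\<Sum>m\<in>Poly_Mapping.keys p. Poly_Mapping.lookup p m *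
     (\<Prod>i\<in>UNIV. bernstein_coeff n (Poly_Mapping.lookup m i) (K i)))"

text \<open>Each exponent is at most \<open>pdeg p\<close>, so every variable power expands in
  degree \<open>n\<close>; multiplying out turns the product of sums into a sum over
  multi-indices.\<close>

lemma bernstein_expansion:
  fixes p :: "'v::finite rpoly"
  assumes "pdeg p \<le> n"
  shows "p = (\<Sum>K\<in>PiE UNIV (\<lambda>_. {..n}). pconst (poly_bernstein_coeff n p K) *
    (\<Prod>i\<in>UNIV. bernstein n (K i) i))"
proof -
  have mono: "Poly_Mapping.single m c = (\<Sum>K\<in>PiE UNIV (\<lambda>_. {..n}).
      pconst (c * (\<Prod>i\<in>UNIV. bernstein_coeff n (Poly_Mapping.lookup m i) (K i))) *
      (\<Prod>i\<in>UNIV. bernstein n (K i) i))" if "m \<in> Poly_Mapping.keys p" for m c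
  proof -
    have "Poly_Mapping.lookup m i \<le> n" for i
    proof -
      have "Poly_Mapping.lookup m i \<le> mdeg m"
        unfolding mdeg_eq_sum by (rule member_le_sum) auto
      then show ?thesis using mdeg_le_pdeg[OF that] assms by simp
    qed
    then have "Poly_Mapping.single m c = pconst c * (\<Prod>i\<in>UNIV. \<Sum>k\<le>n.
        pconst (bernstein_coeff n (Poly_Mapping.lookup m i) k) * bernstein n k i)"
      by (simp add: monomial_eq_prod_pvar[of m c] pvar_power_eq_bernstein_sum[of _ n])
    then show ?thesis
      by (simp add: prod_sum_PiE prod.distrib pconst_prod pconst_mult sum_distrib_left mult.assoc)
  qed
  have "p = (\<Sum>m\<in>Poly_Mapping.keys p. Poly_Mapping.single m (Poly_Mapping.lookup p m))"
    by (simp only: sum_monomials)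
  also have "\<dots> = (\<Sum>m\<in>Poly_Mapping.keys p. \<Sum>K\<in>PiE UNIV (\<lambda>_. {..n}).
      pconst (Poly_Mapping.lookup p m *
        (\<Prod>i\<in>UNIV. bernstein_coeff n (Poly_Mapping.lookup m i) (K i))) *
      (\<Prod>i\<in>UNIV. bernstein n (K i) i))"
    by (rule sum.cong[OF refl]) (rule mono)
  also have "\<dots> = (\<Sum>K\<in>PiE UNIV (\<lambda>_. {..n}). pconst (poly_bernstein_coeff n p K) *
      (\<Prod>i\<in>UNIV. bernstein n (K i) i))"
    by (subst sum.swap) (simp add: poly_bernstein_coeff_def pconst_sum sum_distrib_right)
  finally show ?thesis .
qed

text \<open>A failure for infinitely many degrees would, along a subsequence of grid points
  converging in the box, force the polynomial to be nonpositive at the limit point.\<close>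

lemma eventually_poly_bernstein_coeff_nonneg:
  fixes p :: "'v::finite rpoly"
  assumes pos: "\<And>x :: real ^ 'v. (\<And>i. \<bar>x $ i\<bar> \<le> 1) \<Longrightarrow> 0 < peval p (\<lambda>i. x $ i)"
  shows "\<exists>n\<ge>pdeg p. \<forall>K\<in>PiE UNIV (\<lambda>_. {..n}). 0 \<le> poly_bernstein_coeff n p K"
proof (rule ccontr)
  assume "\<not> ?thesis"
  then have "\<exists>K\<in>PiE UNIV (\<lambda>_. {..n}). poly_bernstein_coeff n p K < 0" if "n \<ge> pdeg p" for n
    using that by (meson not_le)
  \<comment> \<open>The shift makes every degree at least \<open>pdeg p\<close> and also positive,
    so that grid points can be formed by division.\<close>
  from this[of "m + Suc (pdeg p)" for m]
  have "\<exists>K. \<forall>m. K m \<in> PiE UNIV (\<lambda>_. {..m + Suc (pdeg p)}) \<and>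
      poly_bernstein_coeff (m + Suc (pdeg p)) p (K m) < 0"
    by (intro choice allI) (simp add: Bex_def)
  then obtain K where K: "\<And>m. K m \<in> PiE UNIV (\<lambda>_. {..m + Suc (pdeg p)})"
    and neg: "\<And>m. poly_bernstein_coeff (m + Suc (pdeg p)) p (K m) < 0"
    by blast
  define z :: "nat \<Rightarrow> real ^ 'v" where
    "z m = (\<chi> i. real (K m i) / real (m + Suc (pdeg p)))" for m
  have Kle: "K m i \<le> m + Suc (pdeg p)" for m i
    using K[of m] by (auto simp: PiE_iff)
  have zbox: "z m \<in> cbox 0 1" for m
  proof -
    have "real (K m i) / real (m + Suc (pdeg p)) \<le> 1" for i
      using Kle[of m i] by (intro divide_le_eq_1_pos[THEN iffD2]) linarith+
    then show ?thesis by (simp add: z_def mem_box_cart)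
  qed
  obtain t r where t: "t \<in> cbox 0 1" and r: "strict_mono r" and lim: "(z \<circ> r) \<longlonglongrightarrow> t"
    using compact_cbox[of "0 :: real ^ 'v" 1] zbox unfolding compact_def by metis
  define N where "N m = r m + Suc (pdeg p)" for m
  have N: "filterlim N at_top sequentially"
    unfolding N_def using filterlim_subseq[OF r]
    by (rule filterlim_at_top_mono) auto
  have k: "(\<lambda>m. real (K (r m) i) / real (N m)) \<longlonglongrightarrow> t $ i" for i
    using tendsto_vec_nth[OF lim, of i] by (simp add: o_def z_def N_def)
  \<comment> \<open>The grid points lie in the unit cube; \<open>2 t - 1\<close> carries their limit
    to the cube on which \<open>p\<close> is positive.\<close>
  have "(\<lambda>m. poly_bernstein_coeff (N m) p (K (r m))) \<longlonglongrightarrow> peval p (\<lambda>i. (\<chi> i. 2 * t $ i - 1) $ i)"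
    unfolding poly_bernstein_coeff_def peval_meval meval_def vec_lambda_beta
    by (intro tendsto_intros bernstein_coeff_tendsto[OF N k])
  moreover have "0 < peval p (\<lambda>i. (\<chi> i. 2 * t $ i - 1) $ i)"
    by (rule pos) (use t in \<open>auto simp: mem_box_cart abs_le_iff\<close>)
  ultimately have "\<forall>\<^sub>F m in sequentially. 0 < poly_bernstein_coeff (N m) p (K (r m))"
    by (rule order_tendstoD)
  then obtain m where "0 < poly_bernstein_coeff (N m) p (K (r m))"
    by (auto simp: eventually_sequentially)
  with neg[of "r m"] show False by (simp add: N_def)
qed

text \<open>In a Bernstein expansion with nonnegative coefficients every term is a product of
  members of \<open>sphere_sos\<close>.\<close>

lemma box_positive_imp_sphere_sos:
  fixes p :: "'v::finite rpoly"
  assumes "\<And>x :: real ^ 'v. (\<And>i. \<bar>x $ i\<bar> \<le> 1) \<Longrightarrow> 0 < peval p (\<lambda>i. x $ i)"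
  shows "p \<in> sphere_sos"
proof -
  obtain n where "n \<ge> pdeg p" and n: "\<forall>K\<in>PiE UNIV (\<lambda>_. {..n}). 0 \<le> poly_bernstein_coeff n p K"
    using eventually_poly_bernstein_coeff_nonneg[OF assms] by blast
  then have "p = (\<Sum>K\<in>PiE UNIV (\<lambda>_. {..n}). pconst (poly_bernstein_coeff n p K) *
      (\<Prod>i\<in>UNIV. bernstein n (K i) i))"
    by (intro bernstein_expansion)
  moreover have "\<dots> \<in> sphere_sos"
    using n by (intro sphere_sos_sum sphere_sos_mult sphere_sos_prod sphere_sos_pconst
        bernstein_in_sphere_sos) auto
  ultimately show ?thesis by simp
qed

section \<open>Positivity on the sphere and Putinar's theorem\<close>

text \<open>A penalty argument: \<open>g\<close> has a positive minimum on the compact set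
  \<open>D\<close> where \<open>f \<le> 0\<close>, so a large multiple of it outweighs
  \<open>f\<close> there; off \<open>D\<close> the nonnegative term does no harm.\<close>

lemma compact_positive_on_zero_set:
  fixes f g :: "'a::t2_space \<Rightarrow> real"
  assumes C: "compact C" and f: "continuous_on C f" and g: "continuous_on C g"
    and g0: "\<And>x. x \<in> C \<Longrightarrow> 0 \<le> g x"
    and pos: "\<And>x. x \<in> C \<Longrightarrow> g x = 0 \<Longrightarrow> 0 < f x"
  obtains c where "0 \<le> c" "\<And>x. x \<in> C \<Longrightarrow> 0 < f x + c * g x"
proof -
  define D where "D = {x \<in> C. f x \<le> 0}"
  have "compact D"
  proof -
    have "closed (C \<inter> f -` {..0})"
      by (intro continuous_closed_preimage f compact_imp_closed C closed_atMost)
    then have "compact (C \<inter> (C \<inter> f -` {..0}))" by (rule compact_Int_closed[OF C])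
    moreover have "C \<inter> (C \<inter> f -` {..0}) = D" by (auto simp: D_def)
    ultimately show ?thesis by simp
  qed
  show ?thesis
  proof (cases "D = {}")
    case True
    then show ?thesis using that[of 0] by (auto simp: D_def not_le)
  next
    case False
    have "continuous_on D f" "continuous_on D g"
      using f g by (auto simp: D_def intro: continuous_on_subset)
    then obtain x0 y0 where x0: "x0 \<in> D" "\<And>x. x \<in> D \<Longrightarrow> g x0 \<le> g x"
      and y0: "\<And>x. x \<in> D \<Longrightarrow> f y0 \<le> f x"
      using continuous_attains_inf[OF \<open>compact D\<close> False] by metis
    have "0 < g x0"
      using x0(1) pos[of x0] g0[of x0] by (force simp: D_def)
    \<comment> \<open>On \<open>D\<close> this yields
      \<open>c * g x \<ge> \<bar>f y0\<bar> + 1\<close>, which outweighs the minimum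
      \<open>f y0\<close> of \<open>f\<close>.\<close>
    define c where "c = (\<bar>f y0\<bar> + 1) / g x0"
    have c: "0 \<le> c" using \<open>0 < g x0\<close> by (simp add: c_def)
    show ?thesis
    proof (rule that[OF c])
      fix x assume "x \<in> C"
      show "0 < f x + c * g x"
      proof (cases "x \<in> D")
        case True
        have "\<bar>f y0\<bar> + 1 = c * g x0" using \<open>0 < g x0\<close> by (simp add: c_def)
        also have "\<dots> \<le> c * g x" using x0(2)[OF True] c by (rule mult_left_mono)
        finally show ?thesis using y0[OF True] by linarith
      next
        case False
        then show ?thesis
          using \<open>x \<in> C\<close> c g0[of x] by (auto simp: D_def not_le intro: add_pos_nonneg)
      qed
    qed
  qed
qed

lemma sphere_positive_imp_sphere_sos:
  fixes p :: "'v::finite rpoly"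
  assumes pos: "\<And>x :: real ^ 'v. norm x = 1 \<Longrightarrow> 0 < peval p (\<lambda>i. x $ i)"
  shows "p \<in> sphere_sos"
proof -
  let ?g = "\<lambda>x :: real ^ 'v. ((norm x)\<^sup>2 - 1)\<^sup>2"
  obtain c where c: "\<And>x. x \<in> cbox (- 1) (1 :: real ^ 'v) \<Longrightarrow> 0 < peval p (\<lambda>i. x $ i) + c * ?g x"
  proof (rule compact_positive_on_zero_set[of "cbox (- 1) (1 :: real ^ 'v)" "\<lambda>x. peval p (\<lambda>i. x $ i)" ?g])
    show "0 < peval p (\<lambda>i. x $ i)" if "?g x = 0" for x :: "real ^ 'v"
      using that pos[of x] norm_ge_zero[of x] by (auto simp: power2_eq_1_iff simp del: norm_ge_zero)
  qed (auto intro!: continuous_intros continuous_on_peval)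
  let ?e = "sqnorm_poly - 1 :: 'v rpoly"
  have "p + pconst c * ?e\<^sup>2 \<in> sphere_sos"
    by (rule box_positive_imp_sphere_sos)
      (use c in \<open>auto simp: peval_sqnorm_poly mem_box_cart abs_le_iff minus_le_iff\<close>)
  then obtain s q where "sos s" "p + pconst c * ?e\<^sup>2 = s + q * ?e"
    by (auto simp: sphere_sos_def)
  \<comment> \<open>The penalty is a multiple of the sphere relation, so the cofactor absorbs
    it.\<close>
  moreover from this have "p = s + (q - pconst c * ?e) * ?e"
    by (metis (no_types, lifting) add_diff_eq diff_eq_eq left_diff_distrib mult.assoc power2_eq_square)
  ultimately show ?thesis unfolding sphere_sos_def by blast
qed

text \<open>For \<open>t \<ge> 0\<close>, Bernoulli gives
  \<open>n t (1 - t) ^ n \<le> (1 + t) ^ n (1 - t) ^ n \<le> 1\<close>. For \<open>t < 0\<close> the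
  power is at least 1, so the product is at most \<open>t\<close>. The \<open>max\<close> term
  merges both cases.\<close>

lemma mult_power_one_minus_le:
  fixes t :: real
  assumes "\<bar>t\<bar> \<le> 1" "0 < n"
  shows "t * (1 - t) ^ n \<le> 1 / real n - max 0 (- t)"
proof (cases "0 \<le> t")
  case True
  have "real n * t * (1 - t) ^ n \<le> (1 + real n * t) * (1 - t) ^ n"
    using assms by (intro mult_right_mono) auto
  also have "\<dots> \<le> (1 + t) ^ n * (1 - t) ^ n"
    using assms True Bernoulli_inequality[of t n] by (intro mult_right_mono) auto
  also have "\<dots> = (1 - t\<^sup>2) ^ n"
    by (simp add: power_mult_distrib[symmetric] algebra_simps power2_eq_square)
  also have "\<dots> \<le> 1"
    using assms by (intro power_le_one) (auto simp: abs_square_le_1)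
  finally show ?thesis using assms True by (simp add: field_simps)
next
  case False
  have "1 \<le> (1 - t) ^ n" using False by (intro one_le_power) auto
  then have "t * (1 - t) ^ n \<le> t * 1" using False by (intro mult_left_mono_neg) auto
  also have "\<dots> \<le> 1 / real n - max 0 (- t)" using False by simp
  finally show ?thesis .
qed

text \<open>On \<open>[-1, 1]\<close>, \<open>t (1 - t)\<^sup>2\<^sup>k\<close> is close to \<open>0\<close> for \<open>t \<ge> 0\<close> and at most \<open>t\<close>
  for \<open>t \<le> 0\<close>. Subtracting large multiples of these elements of the quadratic module, taken at
  the scaled generators, therefore makes \<open>f\<close> positive on the whole sphere.\<close>

lemma putinar_sphere:
  fixes f :: "'v::finite rpoly"
  assumes fin: "finite H" and sphere: "sqnorm_poly - 1 \<in> H" "1 - sqnorm_poly \<in> H"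
    and pos: "\<And>x :: real ^ 'v. norm x = 1 \<Longrightarrow> (\<And>h. h \<in> H \<Longrightarrow> 0 \<le> peval h (\<lambda>i. x $ i)) \<Longrightarrow>
      0 < peval f (\<lambda>i. x $ i)"
  shows "f \<in> quadratic_module H"
proof -
  let ?S = "sphere 0 1 :: (real ^ 'v) set"
  let ?ev = "\<lambda>p (x :: real ^ 'v). peval p (\<lambda>i. x $ i)"
  let ?g = "\<lambda>x. \<Sum>h\<in>H. max 0 (- ?ev h x)"
  \<comment> \<open>\<open>?g\<close> is the total violation of the constraints and vanishes exactly
    where all generators are nonnegative; \<open>\<mu>\<close> is its penalty weight.\<close>
  obtain \<mu> where \<mu>: "0 \<le> \<mu>" "\<And>x. x \<in> ?S \<Longrightarrow> 0 < ?ev f x + \<mu> * ?g x"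
  proof (rule compact_positive_on_zero_set[of ?S "?ev f" ?g])
    show "0 < ?ev f x" if "x \<in> ?S" "?g x = 0" for x
    proof (rule pos)
      have "\<forall>h\<in>H. max 0 (- ?ev h x) = 0"
        using that(2) fin by (subst (asm) sum_nonneg_eq_0_iff) auto
      then show "0 \<le> ?ev h x" if "h \<in> H" for h
        using that by (auto simp: max_def split: if_splits)
    qed (use that in simp)
  qed (auto intro!: continuous_intros continuous_on_peval sum_nonneg)
  \<comment> \<open>Compactness turns positivity into a margin, which will pay for replacing the
    violation by polynomials.\<close>
  obtain \<delta> where \<delta>: "0 < \<delta>" "\<And>x. x \<in> ?S \<Longrightarrow> \<delta> \<le> ?ev f x + \<mu> * ?g x"
  proof (cases "?S = {}")
    case True
    then show ?thesis using that[of 1] by auto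
  next
    case False
    have "continuous_on ?S (\<lambda>x. ?ev f x + \<mu> * ?g x)"
      by (intro continuous_intros continuous_on_peval)
    then obtain x0 where "x0 \<in> ?S" "\<And>x. x \<in> ?S \<Longrightarrow> ?ev f x0 + \<mu> * ?g x0 \<le> ?ev f x + \<mu> * ?g x"
      using continuous_attains_inf[OF compact_sphere False] by blast
    then show ?thesis using that \<mu>(2) by blast
  qed
  have "\<exists>b. \<forall>x\<in>?S. \<bar>?ev h x\<bar> \<le> b" for h
  proof -
    have "bounded (?ev h ` ?S)"
      by (intro compact_imp_bounded compact_continuous_image continuous_on_peval compact_sphere)
    then show ?thesis by (auto simp: bounded_iff)
  qed
  then obtain b where b: "\<And>h x. x \<in> ?S \<Longrightarrow> \<bar>?ev h x\<bar> \<le> b h" by metis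
  \<comment> \<open>A common scale bringing all generators into \<open>[-1, 1]\<close> on the
    sphere; the summand 1 makes it positive.\<close>
  define R where "R = 1 + (\<Sum>h\<in>H. \<bar>b h\<bar>)"
  have R: "0 < R" by (simp add: R_def add_pos_nonneg sum_nonneg)
  have hR: "\<bar>?ev h x\<bar> \<le> R" if "x \<in> ?S" "h \<in> H" for h x
    using b[OF that(1), of h] member_le_sum[OF that(2), of "\<lambda>h. \<bar>b h\<bar>"] fin by (simp add: R_def)
  \<comment> \<open>Each generator will cost an error of at most \<open>\<mu> * R / k\<close>; this
    choice keeps their sum below \<open>\<delta>\<close>.\<close>
  obtain k where k: "\<mu> * R * real (card H) / \<delta> < real k"
    using reals_Archimedean2 by blast
  moreover have "0 \<le> \<mu> * R * real (card H) / \<delta>" using \<mu> R \<delta> by simp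
  ultimately have k0: "0 < k" by (meson le_less_trans of_nat_0_less_iff)
  \<comment> \<open>The outer square makes the multiplier a sum of squares, so the exponent in
    \<open>mult_power_one_minus_le\<close> is \<open>2 k\<close>.\<close>
  define s where "s h = pconst \<mu> * ((1 - pconst (1 / R) * h) ^ k)\<^sup>2" for h :: "'v rpoly"
  have s: "sos (s h)" for h
    unfolding s_def using \<mu> by (intro sos_mult sos_pconst sos_square)
  have bound: "?ev (s h * h) x \<le> \<mu> * (R / real k) - \<mu> * max 0 (- ?ev h x)"
    if "x \<in> ?S" "h \<in> H" for h x
  proof -
    define t where "t = ?ev h x / R"
    have h: "?ev h x = R * t" using R by (simp add: t_def)
    have "\<bar>t\<bar> \<le> 1" using hR[OF that] R by (simp add: t_def abs_divide)
    then have "t * (1 - t) ^ (k * 2) \<le> 1 / real (k * 2) - max 0 (- t)"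
      using k0 by (intro mult_power_one_minus_le) auto
    also have "\<dots> \<le> 1 / real k - max 0 (- t)" using k0 by (simp add: field_simps)
    finally have "\<mu> * (R * (t * (1 - t) ^ (k * 2))) \<le> \<mu> * (R * (1 / real k - max 0 (- t)))"
      using \<mu> R by (intro mult_left_mono) auto
    also have "R * max 0 (- t) = max 0 (- (R * t))"
      using R by (auto simp: max_def zero_le_mult_iff mult_le_0_iff)
    then have "\<mu> * (R * (1 / real k - max 0 (- t))) = \<mu> * (R / real k) - \<mu> * max 0 (- ?ev h x)"
      by (simp add: h right_diff_distrib)
    finally show ?thesis
      using R by (simp add: s_def h power_mult mult_ac)
  qed
  let ?q = "f - (\<Sum>h\<in>H. s h * h)"
  have "?q \<in> sphere_sos"
  proof (rule sphere_positive_imp_sphere_sos)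
    fix x :: "real ^ 'v" assume "norm x = 1"
    then have x: "x \<in> ?S" by simp
    have "(\<Sum>h\<in>H. ?ev (s h * h) x) \<le> (\<Sum>h\<in>H. \<mu> * (R / real k) - \<mu> * max 0 (- ?ev h x))"
      using bound[OF x] by (rule sum_mono)
    also have "\<dots> = \<mu> * R * real (card H) / real k - \<mu> * ?g x"
      by (simp add: sum_subtractf sum_distrib_left mult_ac)
    also have "\<mu> * R * real (card H) / real k < \<delta>"
      using k k0 \<delta> by (simp add: field_simps)
    finally have "(\<Sum>h\<in>H. ?ev (s h * h) x) < \<delta> - \<mu> * ?g x" by simp
    then have "0 < ?ev f x - (\<Sum>h\<in>H. ?ev (s h * h) x)"
      using \<delta>(2)[OF x] by linarith
    then show "0 < ?ev ?q x" by (simp only: peval_diff peval_sum)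
  qed
  then have "?q \<in> quadratic_module H"
    using sphere_sos_subset_quadratic_module[OF fin sphere] by blast
  moreover have "(\<Sum>h\<in>H. s h * h) \<in> quadratic_module H"
    by (intro quadratic_module_sum sos_mult_in_quadratic_module fin s)
  ultimately have "?q + (\<Sum>h\<in>H. s h * h) \<in> quadratic_module H"
    by (rule quadratic_module_add)
  then show ?thesis by simp
qed

section \<open>Linear forms\<close>

lemma mdeg_eq_1D:
  fixes m :: "'v::finite \<Rightarrow>\<^sub>0 nat"
  assumes "mdeg m = 1"
  obtains i where "m = Poly_Mapping.single i 1"
proof -
  obtain i where i: "Poly_Mapping.lookup m i = 1" "\<And>j. i \<noteq> j \<Longrightarrow> Poly_Mapping.lookup m j = 0"
    using assms unfolding mdeg_eq_sum sum_eq_1_iff[OF finite] by blast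
  have "m = Poly_Mapping.single i 1"
    by (rule poly_mapping_eqI) (use i in \<open>auto simp: lookup_single when_def\<close>)
  then show ?thesis by (rule that)
qed

lemma peval_linform:
  fixes l :: "'v::finite rpoly"
  assumes "l \<in> linforms"
  shows "peval l (\<lambda>i. u * x i + v * y i) = u * peval l x + v * peval l y"
proof -
  have "meval m (\<lambda>i. u * x i + v * y i) = u * meval m x + v * meval m y"
    if m: "m \<in> Poly_Mapping.keys l" for m
  proof -
    have "mdeg m = 1" using assms m by (auto simp: linforms_def)
    then obtain i where "m = Poly_Mapping.single i 1" by (rule mdeg_eq_1D)
    then show ?thesis by (simp add: meval_single)
  qed
  then show ?thesis
    by (simp add: peval_meval sum_distrib_left sum.distrib[symmetric] algebra_simps)
qed

definition linform :: "real ^ 'v \<Rightarrow> 'v::finite rpoly" where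
  "linform a = (\<Sum>i\<in>UNIV. Poly_Mapping.single (Poly_Mapping.single i 1) (a $ i))"

lemma linform_in_linforms: "linform a \<in> linforms"
proof -
  have "mdeg (Poly_Mapping.single (i :: 'a) 1) = 1" for i
    by (simp add: mdeg_def)
  moreover have "Poly_Mapping.keys (linform a) \<subseteq> (\<Union>i. {Poly_Mapping.single i 1})"
    unfolding linform_def by (rule order_trans[OF keys_sum]) auto
  ultimately show ?thesis by (auto simp: linforms_def)
qed

lemma peval_linform_inner: "peval (linform a) (\<lambda>i. x $ i) = a \<bullet> x"
  by (simp add: linform_def peval_sum peval_single meval_single inner_vec_def)

section \<open>Homogeneous coordinates\<close>

text \<open>The point \<open>hpt 1 x\<close> as a vector, so that norms, limits and inner products
  apply.\<close>

definition homog_vec :: "real ^ 'n \<Rightarrow> real ^ 'n::finite option" where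
  "homog_vec x = (\<chi> j. hpt 1 x j)"

definition dehomog_vec :: "real ^ 'n option \<Rightarrow> real ^ 'n::finite" where
  "dehomog_vec y = (\<chi> i. y $ Some i / y $ None)"

lemma homog_vec_nth [simp]: "homog_vec x $ None = 1" "homog_vec x $ Some i = x $ i"
  by (simp_all add: homog_vec_def hpt_def)

lemma hpt_eq: "hpt 1 x = (\<lambda>j. homog_vec x $ j)"
  by (simp add: homog_vec_def)

lemma dehomog_homog [simp]: "dehomog_vec (homog_vec x) = x"
  by (simp add: dehomog_vec_def)

lemma homog_dehomog:
  assumes "y $ None \<noteq> 0"
  shows "y $ None *\<^sub>R homog_vec (dehomog_vec y) = y"
proof (rule vec_eq_iff[THEN iffD2], rule allI)
  fix j show "(y $ None *\<^sub>R homog_vec (dehomog_vec y)) $ j = y $ j"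
    using assms by (cases j) (simp_all add: dehomog_vec_def)
qed

text \<open>Rescaling to first coordinate 1 changes each homogenized constraint by a positive factor
  only.\<close>

lemma Stilde_o_iff:
  "y \<in> Stilde_o gs \<longleftrightarrow> 0 < y $ None \<and> dehomog_vec y \<in> semialg gs"
proof (cases "0 < y $ None")
  case True
  have "peval (homog g) (hvec y) = (y $ None) ^ pdeg g * peval g (\<lambda>i. dehomog_vec y $ i)" for g
    using peval_homog_scale[of g "y $ None" "homog_vec (dehomog_vec y)"] True
    by (simp add: homog_dehomog peval_homog_one)
  then show ?thesis
    using True zero_less_power[OF True]
    by (simp add: Stilde_o_def semialg_def zero_le_mult_iff not_le[symmetric])
qed (simp add: Stilde_o_def)

lemma Stilde_o_subset_Stilde_c: "Stilde_o gs \<subseteq> Stilde_c gs"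
  by (auto simp: Stilde_o_def Stilde_c_def)

lemma homog_vec_in_Stilde_o: "x \<in> semialg gs \<Longrightarrow> homog_vec x \<in> Stilde_o gs"
  by (simp add: Stilde_o_iff)

lemma cone_Stilde_c: "cone (Stilde_c gs)"
  by (auto simp: cone_def Stilde_c_def peval_homog_scale)

text \<open>Dehomogenization sends convex combinations to convex combinations, with weights rescaled
  by the first coordinates; hence \<open>?P\<close> is convex.\<close>

lemma convex_hull_Stilde_o:
  assumes "y \<in> convex hull (Stilde_o gs)"
  shows "0 < y $ None" "dehomog_vec y \<in> convex hull (semialg gs)"
proof -
  let ?P = "{y. 0 < y $ None \<and> dehomog_vec y \<in> convex hull (semialg gs)}"
  have "convex ?P"
  proof (rule convexI)
    fix y z u v assume y: "y \<in> ?P" and z: "z \<in> ?P" and uv: "0 \<le> u" "0 \<le> v" "u + v = (1::real)"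
    define t where "t = u * y $ None + v * z $ None"
    have t: "0 < t"
    proof (cases "u = 0")
      case False
      then have "0 < u * y $ None" using y uv by simp
      then show ?thesis using z uv by (simp add: t_def add_pos_nonneg)
    qed (use z uv in \<open>simp add: t_def\<close>)
    have "dehomog_vec (u *\<^sub>R y + v *\<^sub>R z) =
        (u * y $ None / t) *\<^sub>R dehomog_vec y + (v * z $ None / t) *\<^sub>R dehomog_vec z"
      using y z t by (simp add: vec_eq_iff dehomog_vec_def t_def[symmetric] add_divide_distrib)
    moreover have "\<dots> \<in> convex hull (semialg gs)"
      using y z uv t
      by (intro convexD[OF convex_convex_hull]) (auto simp: t_def add_divide_distrib[symmetric])
    ultimately show "u *\<^sub>R y + v *\<^sub>R z \<in> ?P"
      using t by (simp add: t_def)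
  qed
  moreover have "Stilde_o gs \<subseteq> ?P"
    by (auto simp: Stilde_o_iff hull_inc)
  ultimately have "convex hull (Stilde_o gs) \<subseteq> ?P" by (rule hull_minimal[rotated])
  then show "0 < y $ None" "dehomog_vec y \<in> convex hull (semialg gs)" using assms by auto
qed

text \<open>Approximate by points of the hull of the open cone and dehomogenize; this is continuous
  at \<open>homog_vec x\<close>, whose first coordinate is 1.\<close>

lemma closure_convex_hull_semialg:
  assumes "homog_vec x \<in> convex hull (closure (Stilde_o gs))"
  shows "x \<in> closure (convex hull (semialg gs))"
proof -
  have "convex hull (closure (Stilde_o gs)) \<subseteq> closure (convex hull (Stilde_o gs))"
    by (intro hull_minimal closure_mono hull_subset convex_closure convex_convex_hull)
  with assms have "homog_vec x \<in> closure (convex hull (Stilde_o gs))" by blast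
  then obtain y where y: "\<And>n. y n \<in> convex hull (Stilde_o gs)" and lim: "y \<longlonglongrightarrow> homog_vec x"
    unfolding closure_sequential by blast
  have "(\<lambda>n. dehomog_vec (y n)) \<longlonglongrightarrow> dehomog_vec (homog_vec x)"
    unfolding dehomog_vec_def
    by (intro tendsto_vec_lambda tendsto_divide tendsto_vec_nth lim) simp
  then show ?thesis
    using convex_hull_Stilde_o(2)[OF y] unfolding closure_sequential dehomog_homog
    by (intro exI[of _ "\<lambda>n. dehomog_vec (y n)"]) auto
qed

section \<open>Separation from a pointed cone\<close>

text \<open>A vanishing convex combination of two nonzero members would make one a negative multiple
  of the other, contradicting pointedness.\<close>

lemma convex_pointed_cone_minus_0:
  assumes "convex K" "cone K" "pointed K"
  shows "convex (K - {0})"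
proof (rule convexI)
  fix x y u v assume x: "x \<in> K - {0}" and y: "y \<in> K - {0}" and uv: "0 \<le> u" "0 \<le> v" "u + v = (1::real)"
  have "u *\<^sub>R x + v *\<^sub>R y \<noteq> 0"
  proof
    assume eq: "u *\<^sub>R x + v *\<^sub>R y = 0"
    have "u \<noteq> 0" using eq uv y by auto
    then have "x = - ((v / u) *\<^sub>R y)"
      using eq by (simp add: divide_inverse_commute eq_neg_iff_add_eq_0 flip: scaleR_scaleR)
        (metis scaleR_add_right scaleR_one scaleR_scaleR scaleR_zero_right left_inverse)
    moreover have "(v / u) *\<^sub>R y \<in> K"
      using y uv assms(2) by (simp add: cone_def)
    ultimately have "x \<in> K \<inter> uminus ` K" using x by auto
    then show False using assms(3) x by (auto simp: pointed_def)
  qed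
  then show "u *\<^sub>R x + v *\<^sub>R y \<in> K - {0}"
    using convexD[OF assms(1)] x y uv by auto
qed

text \<open>Both requirements say that \<open>a\<close> is positive on the compact set
  \<open>insert (- w) B\<close>, so it suffices that its hull avoids 0. If \<open>u w = v b\<close>
  with \<open>b\<close> in the hull of \<open>B\<close>, then \<open>u = 0\<close> forces
  \<open>b = 0\<close>, and \<open>u > 0\<close> puts \<open>w\<close> into
  \<open>K\<close>.\<close>

lemma separate_from_pointed_cone:
  fixes K :: "'a::euclidean_space set"
  assumes K: "convex K" "cone K" "pointed K" and w: "w \<notin> K"
    and B: "compact B" "B \<noteq> {}" "B \<subseteq> K - {0}"
  obtains a where "a \<bullet> w < 0" "\<And>y. y \<in> B \<Longrightarrow> 0 < a \<bullet> y"
proof -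
  have hull: "convex hull B \<subseteq> K - {0}"
    using B(3) convex_pointed_cone_minus_0[OF K] by (rule hull_minimal)
  have "0 \<notin> convex hull (insert (- w) B)"
  proof
    assume "0 \<in> convex hull (insert (- w) B)"
    then obtain u v b where uv: "0 \<le> u" "0 \<le> v" "u + v = 1" and b: "b \<in> convex hull B"
      and eq: "0 = u *\<^sub>R (- w) + v *\<^sub>R b"
      unfolding convex_hull_insert[OF B(2)] by auto
    have b': "b \<in> K" "b \<noteq> 0" using b hull by auto
    have "u \<noteq> 0" using eq uv b' by auto
    moreover have "u *\<^sub>R w = v *\<^sub>R b" using eq by simp
    ultimately have "w = (v / u) *\<^sub>R b"
      by (metis divide_inverse_commute left_inverse scaleR_one scaleR_scaleR)
    then show False using w b' K(2) uv by (simp add: cone_def)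
  qed
  moreover have "closed (convex hull (insert (- w) B))"
    using B(1) by (intro compact_imp_closed compact_convex_hull compact_insert)
  ultimately obtain a b where "0 < b" and ab: "\<forall>x\<in>convex hull (insert (- w) B). b < a \<bullet> x"
    using separating_hyperplane_closed_0[OF convex_convex_hull] by metis
  have "0 < a \<bullet> x" if "x \<in> insert (- w) B" for x
    using ab hull_inc[OF that, of convex] \<open>0 < b\<close> by (meson less_trans)
  from this[of "- w"] this show ?thesis by (intro that) auto
qed

section \<open>The theta body hierarchy\<close>

lemma convex_THk: "convex (THk k gs)"
proof (rule convexI)
  fix x y :: "real ^ 'a" and u v :: real
  assume xy: "x \<in> THk k gs" "y \<in> THk k gs" and uv: "0 \<le> u" "0 \<le> v" "u + v = 1"
  have "hpt 1 (u *\<^sub>R x + v *\<^sub>R y) = (\<lambda>j. u * hpt 1 x j + v * hpt 1 y j)"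
    using uv by (auto simp: hpt_def fun_eq_iff split: option.split)
  then show "u *\<^sub>R x + v *\<^sub>R y \<in> THk k gs"
    using xy uv by (auto simp: THk_def peval_linform)
qed

lemma closed_THk: "closed (THk k gs)"
proof -
  have "continuous_on UNIV (\<lambda>x :: real ^ 'a. hpt 1 x j)" for j
    by (cases j) (auto simp: hpt_def intro!: continuous_intros)
  then have "closed {x :: real ^ 'a. 0 \<le> peval l (hpt 1 x)}" for l
    unfolding peval_meval meval_def by (intro closed_Collect_le continuous_intros)
  moreover have "THk k gs = (\<Inter>l\<in>qmodule k (Gtilde gs) \<inter> linforms. {x. 0 \<le> peval l (hpt 1 x)})"
    by (auto simp: THk_def)
  ultimately show ?thesis by auto
qed

lemma Gtilde_nonneg_iff:
  fixes y :: "real ^ 'n::finite option"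
  assumes "norm y = 1"
  shows "(\<forall>h\<in>Gtilde gs. 0 \<le> peval h (\<lambda>j. y $ j)) \<longleftrightarrow> y \<in> Stilde_c gs"
  using assms by (auto simp: Gtilde_def Stilde_c_def hvec_def peval_sqnorm_poly)

text \<open>The sphere generators force evaluation at a unit vector, so the point is normalized
  within the cone; a linear form changes only by the positive factor \<open>c\<close>.\<close>

lemma semialg_subset_THk: "semialg gs \<subseteq> THk k gs"
proof
  fix x assume "x \<in> semialg gs"
  then have y: "homog_vec x \<in> Stilde_c gs"
    using homog_vec_in_Stilde_o Stilde_o_subset_Stilde_c by blast
  define c where "c = norm (homog_vec x)"
  have c: "0 < c"
    unfolding c_def using homog_vec_nth(1)[of x] by (metis zero_less_norm_iff zero_index zero_neq_one)
  define z where "z = inverse c *\<^sub>R homog_vec x"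
  have z: "z \<in> Stilde_c gs" "norm z = 1"
    using y c cone_Stilde_c[of gs] by (auto simp: z_def cone_def c_def)
  show "x \<in> THk k gs"
    unfolding THk_def
  proof (intro CollectI ballI)
    fix l assume l: "l \<in> qmodule k (Gtilde gs) \<inter> linforms"
    \<comment> \<open>The dummy second summand fits the two-term shape of
      \<open>peval_linform\<close>.\<close>
    have "hpt 1 x = (\<lambda>j. c * z $ j + 0 * z $ j)"
      using c by (auto simp: hpt_eq z_def)
    then have "peval l (hpt 1 x) = c * peval l (\<lambda>j. z $ j)"
      using l peval_linform[of l c "\<lambda>j. z $ j" 0 "\<lambda>j. z $ j"] by simp
    moreover have "0 \<le> peval l (\<lambda>j. z $ j)"
      using l z Gtilde_nonneg_iff[of z gs] by (auto intro: peval_qmodule_nonneg)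
    ultimately show "0 \<le> peval l (hpt 1 x)" using c by simp
  qed
qed

lemma Inter_THk_subset:
  assumes "assumptionA gs"
  shows "(\<Inter>k\<in>{1..}. THk k gs) \<subseteq> closure (convex hull (semialg gs))"
proof (rule subsetI, rule ccontr)
  fix x assume x: "x \<in> (\<Inter>k\<in>{1..}. THk k gs)" and nx: "x \<notin> closure (convex hull (semialg gs))"
  define K where "K = convex hull (Stilde_c gs)"
  have clo: "closure (Stilde_o gs) = Stilde_c gs" and K: "pointed K"
    using assms by (auto simp: assumptionA_def closed_at_infinity_def K_def)
  have w: "homog_vec x \<notin> K"
    using closure_convex_hull_semialg[of x gs] nx by (auto simp: K_def clo)
  define B where "B = Stilde_c gs \<inter> sphere 0 1"
  \<comment> \<open>Pointedness puts 0 into \<open>K\<close>, so the open cone has a point;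
    normalizing it shows \<open>B\<close> nonempty, as the separation lemma requires.\<close>
  have "K \<noteq> {}" using K by (auto simp: pointed_def)
  then obtain y where y: "y \<in> Stilde_o gs"
    using clo by (force simp: K_def)
  then have "y \<noteq> 0" "y \<in> Stilde_c gs"
    using Stilde_o_subset_Stilde_c by (auto simp: Stilde_o_def)
  then have "inverse (norm y) *\<^sub>R y \<in> B"
    using cone_Stilde_c[of gs] by (auto simp: B_def cone_def)
  then have "B \<noteq> {}" by blast
  \<comment> \<open>Closedness at infinity exhibits \<open>Stilde_c gs\<close> as a closure.\<close>
  moreover have "compact B"
    unfolding B_def using clo by (metis closed_Int_compact closed_closure compact_sphere)
  moreover have "B \<subseteq> K - {0}"
    by (auto simp: B_def K_def hull_inc)
  moreover have "convex K" "cone K"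
    by (auto simp: K_def cone_Stilde_c intro: cone_convex_hull)
  ultimately obtain a where a: "a \<bullet> homog_vec x < 0" "\<And>y. y \<in> B \<Longrightarrow> 0 < a \<bullet> y"
    using separate_from_pointed_cone[of K, OF _ _ K w] by metis
  have "linform a \<in> quadratic_module (Gtilde gs)"
  proof (rule putinar_sphere)
    fix y :: "real ^ 'a option"
    assume "norm y = 1" "\<And>h. h \<in> Gtilde gs \<Longrightarrow> 0 \<le> peval h (\<lambda>j. y $ j)"
    then have "y \<in> B" using Gtilde_nonneg_iff[of y gs] by (simp add: B_def)
    then show "0 < peval (linform a) (\<lambda>j. y $ j)"
      by (simp add: peval_linform_inner a(2))
  qed (auto simp: Gtilde_def)
  moreover have "finite (Gtilde gs)" by (simp add: Gtilde_def)
  \<comment> \<open>A single representation has finite degree, so one level of the hierarchy already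
    excludes \<open>x\<close>.\<close>
  ultimately obtain k where "1 \<le> k" "linform a \<in> qmodule k (Gtilde gs)"
    by (auto simp: quadratic_module_eq_Union_qmodule)
  then have "0 \<le> peval (linform a) (hpt 1 x)"
    using x linform_in_linforms[of a] by (auto simp: THk_def)
  then show False using a(1) by (simp add: hpt_eq peval_linform_inner)
qed

theorem mainTheorem6:
  fixes gs :: "'n::finite rpoly list"
  assumes "assumptionA gs"
  shows "(\<forall>k\<ge>1. closure (convex hull (semialg gs)) \<subseteq> THk k gs)
    \<and> (\<forall>k\<ge>1. THk (Suc k) gs \<subseteq> THk k gs)
    \<and> closure (convex hull (semialg gs)) = (\<Inter>k\<in>{1..}. THk k gs)"
proof -
  have "closure (convex hull (semialg gs)) \<subseteq> THk k gs" for k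
    by (intro closure_minimal hull_minimal semialg_subset_THk convex_THk closed_THk)
  moreover have "THk (Suc k) gs \<subseteq> THk k gs" for k
    using qmodule_mono[of k "Suc k" "Gtilde gs"] by (auto simp: THk_def)
  ultimately show ?thesis
    using Inter_THk_subset[OF assms] by blast
qed

end
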